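(* For any positive integer $s$, \[h_\star(1,s)\ge \frac15\cdot2^{(1+o(1))s},\] where the $o(1)$ term denotes a function of $s$ that tends to $0$ as $s\to\infty$.
   Context: Graphs are finite and simple. For a graph $G$, $\star(G)$ is the maximum of the orders (numbers of vertices) of the connected components of $G$. A list assignment $L$ for $G$ assigns to each vertex a set of colors; it is an $s$-list assignment if $|L(v)|\ge s$ for each $v\in V(G)$. An $L$-coloring is a map $\varphi$ on $V(G)$ with $\varphi(v)\in L(v)$ for every $v$ (adjacent vertices may receive the same color). $\chi^{\ell}_{\star,p}(G)$ is the least integer $s$ such that for every $s$-list assignment $L$ of $G$ there is an $L$-coloring $\varphi$ of $G$ with $\star(G[\varphi^{-1}(c)])\le p$ for each color $c$ used by $\varphi$. (In particular $\chi^{\ell}_{\star,1}$ is the usual choosability.) For a positive integer $s$, an $s$-island in a graph $G$ is a non-empty set $I\subseteq V(G)$ such that each vertex in $I$ has less than $s$ neighbors in $G$ not belonging to $I$. $\mathrm{col}_{\star,p}(G)$ is the least positive integer $s$ such that every non-null induced subgraph $H$ of $G$ contains an $s$-island $I$ (of $H$) satisfying $\star(H[I])\le p$. For positive integers $s$ and $p$, $h_\star(p,s)$ is the smallest integer $s'$ such that for some integer $p'$, all graphs $G$ with $\chi^{\ell}_{\star,p}(G)\le s$ satisfy $\mathrm{col}_{\star,p'}(G)\le s'$. *)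

theory Defs
  imports
    Complex_Main
    "HOL-Library.Extended_Real"
    "Graph_Theory.Digraph_Component"
begin

text \<open>
  Finite simple graphs are represented by the locale \<open>pair_graph\<close>: a finite vertex set with a
  symmetric irreflexive edge relation on it. In a symmetric digraph the strongly connected
  components \<open>sccs\<close> are the connected components of the graph.

  The parameters defined below as a least integer with some property are elements of \<^typ>\<open>enat\<close>:
  the infimum is the minimum if there is such an integer, and \<open>\<infinity>\<close> if there is none.
\<close>

text \<open>The value for the null graph, which has no components, is 0.\<close>

definition star_order :: "('a, 'b) pre_digraph \<Rightarrow> nat" where
  "star_order G = Max (insert 0 ((\<lambda>C. card (verts C)) ` pre_digraph.sccs G))"

text \<open>Lists may be infinite; since \<^const>\<open>card\<close> of an infinite set is 0, these are treated separately.\<close>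

definition list_assignment :: "('a, 'b) pre_digraph \<Rightarrow> nat \<Rightarrow> ('a \<Rightarrow> 'c set) \<Rightarrow> bool" where
  "list_assignment G s L \<longleftrightarrow> (\<forall>v \<in> verts G. infinite (L v) \<or> s \<le> card (L v))"

definition list_coloring :: "('a, 'b) pre_digraph \<Rightarrow> ('a \<Rightarrow> 'c set) \<Rightarrow> ('a \<Rightarrow> 'c) \<Rightarrow> bool" where
  "list_coloring G L \<phi> \<longleftrightarrow> (\<forall>v \<in> verts G. \<phi> v \<in> L v)"

text \<open>
  Colors are natural numbers. For finite graphs this is no restriction: the lists can be shrunk to
  finite ones, and then only finitely many colors occur.
\<close>

definition clustered_choosability :: "nat \<Rightarrow> ('a, 'b) pre_digraph \<Rightarrow> enat" where
  "clustered_choosability p G = Inf {enat s | s.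
     \<forall>L :: 'a \<Rightarrow> nat set. list_assignment G s L \<longrightarrow>
       (\<exists>\<phi>. list_coloring G L \<phi> \<and>
         (\<forall>c \<in> \<phi> ` verts G. star_order (G \<restriction> {v \<in> verts G. \<phi> v = c}) \<le> p))}"

definition island :: "('a, 'b) pre_digraph \<Rightarrow> nat \<Rightarrow> 'a set \<Rightarrow> bool" where
  "island G s I \<longleftrightarrow> I \<noteq> {} \<and> I \<subseteq> verts G \<and>
     (\<forall>v \<in> I. card {u \<in> verts G - I. v \<rightarrow>\<^bsub>G\<^esub> u} < s)"

definition clustered_col :: "nat \<Rightarrow> ('a, 'b) pre_digraph \<Rightarrow> enat" where
  "clustered_col p G = Inf {enat s | s. 0 < s \<and>
     (\<forall>H. induced_subgraph H G \<and> verts H \<noteq> {} \<longrightarrow>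
       (\<exists>I. island H s I \<and> star_order (H \<restriction> I) \<le> p))}"

text \<open>Every finite graph is isomorphic to one whose vertices are natural numbers.\<close>

definition h_star :: "nat \<Rightarrow> nat \<Rightarrow> enat" where
  "h_star p s = Inf {enat s' | s'. \<exists>p' :: nat. \<forall>G :: nat pair_pre_digraph.
     pair_graph G \<and> clustered_choosability p (with_proj G) \<le> enat s \<longrightarrow>
     clustered_col p' (with_proj G) \<le> enat s'}"

end

theory Submission
  imports Defs
begin

text \<open>
  For every large \<open>s\<close> and every \<open>p'\<close> there is an \<open>s\<close>-choosable graph with an induced subgraph in
  which every nonempty vertex set with components of order at most \<open>p'\<close> has a vertex with \<open>2 powr ((1 - o(1)) * s)\<close>
  neighbours outside the set: a random bipartite graph of constant average degree. Let \<open>d = 2 powr ((1 - \<delta>) * s)\<close> and take \<open>2 * n\<close>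
  vertices and \<open>2 * d * n\<close> random edges, with \<open>n\<close> huge. Besides its density, what matters about
  such a graph is its \<^emph>\<open>local sparsity\<close>: for a constant \<open>r\<close> depending on \<open>\<delta>\<close>, every nonempty set \<open>X\<close> of at most
  \<open>t\<close> vertices spans fewer than \<open>r * card X\<close> edges, where \<open>t\<close> is roughly
  \<open>n * 2 powr (- s) * s ^ (2 * r)\<close>. A union bound gives this (\<open>exists_sparse_bipartite\<close>).

  \<^emph>\<open>Choosability\<close> (\<open>sparse_bipartite_choosable\<close>). Given lists of size \<open>s\<close>, split the palette into
  colours for the left side and colours for the right side. For a random split, a vertex retains
  fewer than \<open>2 * r\<close> colours with probability at most \<open>2 powr (- s) * s ^ (2 * r)\<close>, so some split
  leaves at most \<open>t / 2\<close> such bad vertices. Adding to the bad vertices, one after the other, vertices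
  with at least \<open>2 * r\<close> neighbours in the current set must stop before \<open>t\<close> is reached, since
  otherwise a set of \<open>t\<close> vertices would span too many edges. The resulting set \<open>X\<close> spans a
  \<open>(2 * r - 1)\<close>-degenerate graph and can be coloured greedily from its lists. Each vertex outside
  \<open>X\<close> has fewer than \<open>2 * r\<close> neighbours in \<open>X\<close>, so one of its at least \<open>2 * r\<close> retained colours is
  still free, and retained colours never conflict with each other across the two sides.

  \<^emph>\<open>Islands\<close> (\<open>clustered_col_greater\<close>). Let \<open>H\<close> be a smallest nonempty induced subgraph with at least
  \<open>d\<close> times as many edges as vertices. Removing a set \<open>C\<close> of at most \<open>t\<close> vertices from \<open>H\<close> destroys
  at least \<open>d * card C\<close> edges, of which fewer than \<open>r * card C\<close> lie inside \<open>C\<close>; so some vertex of \<open>C\<close>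
  has at least \<open>d - r\<close> neighbours in \<open>H\<close> outside \<open>C\<close>. A component of an island with clusters of order
  at most \<open>p' \<le> t\<close> is such a set \<open>C\<close>.

  Hence \<open>h_star 1 s > 2 powr ((1 - \<delta>) * s) - 1\<close> for every \<open>\<delta> > 0\<close> and every large \<open>s\<close>. For the remaining
  \<open>s\<close> the bound \<open>1 \<le> h_star 1 s\<close> suffices, and the exponent function is then read off from
  \<open>h_star 1 s\<close> itself (\<open>exponent_tendsto_zero\<close>); any positive constant could replace \<open>1 / 5\<close>.
\<close>

section \<open>Locally sparse bipartite graphs\<close>

text \<open>
  The relation \<open>E\<close> contains one of the two orientations of each edge, so that \<open>card (E \<inter> X \<times> X)\<close> is
  the number of edges spanned by \<open>X\<close>.
\<close>

definition sparse :: "nat \<Rightarrow> nat \<Rightarrow> ('a \<times> 'a) set \<Rightarrow> bool" where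
  "sparse r t E \<longleftrightarrow>
     (\<forall>X. finite X \<and> X \<noteq> {} \<and> card X \<le> t \<longrightarrow> card (E \<inter> X \<times> X) < r * card X)"

text \<open>
  In terms of probabilities: \<open>j\<close> fixed elements all belong to a random \<open>M\<close>-subset of an \<open>N\<close>-set with
  probability at most \<open>(M / N) ^ j\<close>. Each further element multiplies the probability by
  \<open>(M - j) / (N - j) \<le> M / N\<close>.
\<close>

lemma binomial_diff_mult_power_le:
  assumes "j \<le> M" "M \<le> N"
  shows "((N - j) choose (M - j)) * N ^ j \<le> (N choose M) * M ^ j"
  using assms
proof (induction j)
  case (Suc j)
  let ?a = "N - Suc j" and ?b = "M - Suc j"
  have s: "N - j = Suc ?a" "M - j = Suc ?b" using Suc.prems by auto
  have 1: "(?a choose ?b) * (N - j) = (M - j) * ((N - j) choose (M - j))"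
    using Suc_times_binomial_eq[of ?a ?b] by (simp only: s mult.commute)
  have 2: "(M - j) * N \<le> (N - j) * M"
    using mult_le_mono1[OF Suc.prems(2), of j]
    by (simp add: diff_mult_distrib diff_mult_distrib2 mult.commute diff_le_mono2)
  have IH: "((N - j) choose (M - j)) * N ^ j \<le> (N choose M) * M ^ j" using Suc by simp
  have "(N - j) * ((?a choose ?b) * N ^ Suc j)
      = ((?a choose ?b) * (N - j)) * N * N ^ j" by (simp add: ac_simps)
  also have "\<dots> = ((M - j) * N) * (((N - j) choose (M - j)) * N ^ j)"
    unfolding 1 by (simp add: ac_simps)
  also have "\<dots> \<le> ((N - j) * M) * ((N choose M) * M ^ j)"
    by (intro mult_le_mono 2 IH)
  also have "\<dots> = (N - j) * ((N choose M) * M ^ Suc j)" by (simp add: ac_simps)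
  finally show ?case using Suc.prems by simp
qed simp

text \<open>
  The union bound over the \<open>j\<close>-subsets of \<open>T\<close> contained in the random \<open>M\<close>-subset \<open>E\<close> of \<open>U\<close>.
\<close>

lemma card_subsets_meeting_le:
  assumes "finite U" "T \<subseteq> U" "j \<le> M"
  shows "card {E. E \<subseteq> U \<and> card E = M \<and> j \<le> card (E \<inter> T)}
    \<le> (card T choose j) * ((card U - j) choose (M - j))"
proof -
  have finT: "finite T" using assms finite_subset by blast
  let ?J = "{J. J \<subseteq> T \<and> card J = j}"
  let ?F = "\<lambda>J. {E. E \<subseteq> U \<and> card E = M \<and> J \<subseteq> E}"
  have sub: "{E. E \<subseteq> U \<and> card E = M \<and> j \<le> card (E \<inter> T)} \<subseteq> (\<Union>J\<in>?J. ?F J)"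
  proof
    fix E assume E: "E \<in> {E. E \<subseteq> U \<and> card E = M \<and> j \<le> card (E \<inter> T)}"
    then obtain J where "J \<subseteq> E \<inter> T" "card J = j"
      by (metis (mono_tags, lifting) mem_Collect_eq obtain_subset_with_card_n)
    with E show "E \<in> (\<Union>J\<in>?J. ?F J)" by auto
  qed
  have one: "card (?F J) \<le> (card U - j) choose (M - j)" if J: "J \<in> ?J" for J
  proof -
    have finJ: "finite J" and JU: "J \<subseteq> U" using J assms finT finite_subset by auto
    have "?F J \<subseteq> (\<lambda>K. K \<union> J) ` {K. K \<subseteq> U - J \<and> card K = M - j}"
    proof
      fix E assume E: "E \<in> ?F J"
      then have "E - J \<subseteq> U - J" "card (E - J) = M - j" "E = (E - J) \<union> J"
        using finJ J by (auto simp: card_Diff_subset)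
      then show "E \<in> (\<lambda>K. K \<union> J) ` {K. K \<subseteq> U - J \<and> card K = M - j}" by blast
    qed
    then have "card (?F J) \<le> card {K. K \<subseteq> U - J \<and> card K = M - j}"
      by (rule surj_card_le[rotated]) (simp add: assms(1))
    also have "\<dots> = (card U - j) choose (M - j)"
      using J JU finJ assms(1) by (simp add: n_subsets card_Diff_subset)
    finally show ?thesis .
  qed
  have "card {E. E \<subseteq> U \<and> card E = M \<and> j \<le> card (E \<inter> T)} \<le> card (\<Union>J\<in>?J. ?F J)"
    using sub by (rule card_mono[rotated]) (auto simp: assms(1) finT)
  also have "\<dots> \<le> (\<Sum>J\<in>?J. card (?F J))" by (rule card_UN_le) (simp add: finT)
  also have "\<dots> \<le> card ?J * ((card U - j) choose (M - j))"
    using sum_bounded_above[of ?J "\<lambda>J. card (?F J)"] one by auto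
  finally show ?thesis by (simp add: n_subsets finT)
qed

text \<open>
  A weak Stirling bound: \<open>m ^ m / fact m\<close> is one term of the series for \<open>exp m\<close>, and \<open>exp 1 \<le> 3\<close>.
\<close>

lemma power_self_le_fact: "m ^ m \<le> 3 ^ m * fact m"
proof -
  have "real m ^ m / fact m \<le> (\<Sum>i\<le>m. real m ^ i / fact i)"
    by (rule member_le_sum) auto
  also have "\<dots> \<le> exp (real m)"
    using sum_le_suminf[OF summable_exp_generic[of "real m"], of "{..m}"]
    by (simp add: exp_def divide_inverse mult.commute)
  also have "\<dots> = exp 1 ^ m" by (metis exp_of_nat_mult mult.right_neutral)
  also have "\<dots> \<le> 3 ^ m" using exp_le by (intro power_mono) auto
  finally have "real (m ^ m) \<le> real (3 ^ m * fact m)"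
    by (simp add: divide_le_eq)
  then show ?thesis by (simp only: of_nat_le_iff)
qed

text \<open>
  A set of \<open>x\<close> vertices has at most \<open>x ^ 2\<close> potential edges, of which it must receive \<open>r * x\<close> to violate
  sparsity. The factor \<open>3 ^ (r * x)\<close> lost in the Stirling bound is absorbed by \<open>r \<ge> 3\<close>.
\<close>

lemma binomial_square_le:
  assumes "3 \<le> r"
  shows "(x ^ 2 choose (r * x)) \<le> x ^ (r * x)"
proof (cases "x = 0")
  case False
  have "3 ^ (r * x) * x ^ (r * x) \<le> (r * x) ^ (r * x)"
    using assms by (metis mult_le_mono1 power_mono power_mult_distrib zero_le)
  also have "\<dots> \<le> 3 ^ (r * x) * fact (r * x)" by (rule power_self_le_fact)
  finally have f: "x ^ (r * x) \<le> fact (r * x)" by simp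
  have "(x ^ 2 choose (r * x)) * x ^ (r * x) \<le> (x ^ 2 choose (r * x)) * fact (r * x)"
    using f by simp
  also have "\<dots> \<le> (x ^ 2) ^ (r * x)" by (rule binomial_fact_pow)
  also have "\<dots> = x ^ (r * x) * x ^ (r * x)" by (simp add: power2_eq_square power_mult_distrib)
  finally show ?thesis using False by simp
qed simp

lemma binomial_mult_power_le: "(m choose x) * x ^ x \<le> (3 * m) ^ x"
proof -
  have "(m choose x) * x ^ x \<le> (m choose x) * (3 ^ x * fact x)"
    using power_self_le_fact by simp
  also have "\<dots> = 3 ^ x * ((m choose x) * fact x)" by simp
  also have "\<dots> \<le> 3 ^ x * m ^ x" using binomial_fact_pow by (intro mult_le_mono2)
  finally show ?thesis by (simp add: power_mult_distrib)
qed

text \<open>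
  First moment method for a uniformly random set of \<open>M = 2 * d * n\<close> edges. A given set of size \<open>x\<close> spans
  \<open>r * x\<close> edges with probability at most \<open>(x * M / n\<^sup>2) ^ (r * x)\<close>, and there are at most
  \<open>(6 * n / x) ^ x\<close> sets, so the sets of size \<open>x\<close> contribute at most the \<open>x\<close>-th power of
  \<open>12 * d * (2 * d * x / n) ^ (r - 1)\<close>. The hypothesis on \<open>t\<close> bounds this base by \<open>1 / 2\<close>, and
  \<open>(\<Sum>x=1..t. (1 / 2) ^ x) < 1\<close>.
\<close>

theorem exists_sparse_bipartite:
  fixes n d r t :: nat
  assumes r: "3 \<le> r" and d: "2 * d \<le> n" and n: "0 < n"
    and t: "24 * d * (2 * d * t) ^ (r - 1) \<le> n ^ (r - 1)"
  obtains E where "E \<subseteq> {..<n} \<times> {n..<2 * n}" "card E = 2 * d * n" "sparse r t E"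
proof -
  define U where "U = {..<n} \<times> {n..<2 * n}"
  define M where "M = 2 * d * n"
  have finU: "finite U" and cU: "card U = n\<^sup>2" by (auto simp: U_def power2_eq_square)
  have MU: "M \<le> n\<^sup>2" using d by (simp add: M_def power2_eq_square)
  define C where "C = {E. E \<subseteq> U \<and> card E = M}"
  have cC: "card C = (n\<^sup>2 choose M)" using n_subsets[OF finU] by (simp add: C_def cU)
  have finC: "finite C" using finU by (simp add: C_def)
  have cCpos: "0 < card C" using MU by (simp add: cC)
  let ?Xs = "\<lambda>x. {X. X \<subseteq> {..<2 * n} \<and> card X = x}"
  define bad where "bad = (\<lambda>x X. {E \<in> C. r * x \<le> card (E \<inter> X \<times> X)})"
  define Bad where "Bad = (\<lambda>x. \<Union>X \<in> ?Xs x. bad x X)"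
  have bad_le: "real (card (Bad x)) \<le> card C * (1 / 2) ^ x" if x: "x \<in> {1..t}" for x
  proof (cases "r * x \<le> M")
    case False
    have "bad x X = {}" for X
    proof -
      have "card (E \<inter> X \<times> X) \<le> M" if "E \<in> C" for E
        using that card_mono[of E "E \<inter> X \<times> X"] finU finite_subset by (auto simp: C_def)
      then show ?thesis using False by (fastforce simp: bad_def)
    qed
    then have "Bad x = {}" by (simp add: Bad_def)
    then show ?thesis by simp
  next
    case True
    have bx: "card (bad x X) \<le> x ^ (r * x) * ((n\<^sup>2 - r * x) choose (M - r * x))"
      if X: "X \<in> ?Xs x" for X
    proof -
      have finX: "finite X" using X finite_subset by blast
      have T: "card (U \<inter> X \<times> X) \<le> x\<^sup>2"
        using card_mono[of "X \<times> X" "U \<inter> X \<times> X"] finX X by (simp add: power2_eq_square)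
      have "E \<inter> (U \<inter> X \<times> X) = E \<inter> X \<times> X" if "E \<subseteq> U" for E using that by auto
      then have "bad x X \<subseteq> {E. E \<subseteq> U \<and> card E = M \<and> r * x \<le> card (E \<inter> (U \<inter> X \<times> X))}"
        by (auto simp: bad_def C_def)
      then have "card (bad x X)
          \<le> card {E. E \<subseteq> U \<and> card E = M \<and> r * x \<le> card (E \<inter> (U \<inter> X \<times> X))}"
        by (rule card_mono[rotated]) (simp add: finU)
      also have "\<dots> \<le> (card (U \<inter> X \<times> X) choose (r * x)) * ((n\<^sup>2 - r * x) choose (M - r * x))"
        using card_subsets_meeting_le[OF finU _ True, of "U \<inter> X \<times> X"] by (simp add: cU)
      also have "\<dots> \<le> (x\<^sup>2 choose (r * x)) * ((n\<^sup>2 - r * x) choose (M - r * x))"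
        using T by (intro mult_le_mono1 binomial_right_mono)
      also have "\<dots> \<le> x ^ (r * x) * ((n\<^sup>2 - r * x) choose (M - r * x))"
        using binomial_square_le[OF r] by (intro mult_le_mono1)
      finally show ?thesis .
    qed
    have "card (Bad x) \<le> (\<Sum>X \<in> ?Xs x. card (bad x X))"
      unfolding Bad_def by (rule card_UN_le) simp
    also have "\<dots> \<le> card (?Xs x) * (x ^ (r * x) * ((n\<^sup>2 - r * x) choose (M - r * x)))"
      using sum_bounded_above[of "?Xs x" "\<lambda>X. card (bad x X)"] bx by auto
    also have "card (?Xs x) = (2 * n choose x)" by (simp add: n_subsets)
    finally have c1: "card (Bad x)
      \<le> (2 * n choose x) * (x ^ (r * x) * ((n\<^sup>2 - r * x) choose (M - r * x)))" .
    have "card (Bad x) * (x ^ x * n\<^sup>2 ^ (r * x)) \<le>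
      ((2 * n choose x) * x ^ x) * x ^ (r * x) * (((n\<^sup>2 - r * x) choose (M - r * x)) * n\<^sup>2 ^ (r * x))"
      using mult_le_mono1[OF c1, of "x ^ x * n\<^sup>2 ^ (r * x)"] by (simp add: ac_simps)
    also have "\<dots> \<le> (6 * n) ^ x * x ^ (r * x) * (card C * M ^ (r * x))"
      using binomial_mult_power_le[of "2 * n" x] binomial_diff_mult_power_le[OF True MU]
      by (intro mult_le_mono[OF mult_le_mono1]) (auto simp: cC)
    finally have c2: "card (Bad x) * (x * n\<^sup>2 ^ r) ^ x \<le> card C * (6 * n * (x * M) ^ r) ^ x"
      by (simp add: power_mult power_mult_distrib ac_simps)
    \<comment> \<open>The hypothesis on \<open>t\<close> makes the base of the \<open>x\<close>-th power at most \<open>1 / 2\<close>.\<close>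
    have c3: "2 * (6 * n * (x * M) ^ r) \<le> x * n\<^sup>2 ^ r"
    proof -
      obtain k where k: "r = Suc k" using r by (cases r) auto
      have "2 * (6 * n * (x * M) ^ r) = (24 * d * (2 * d * x) ^ k) * (x * n * n * n ^ k)"
        by (simp add: k M_def power_mult_distrib algebra_simps)
      also have "\<dots> \<le> (24 * d * (2 * d * t) ^ k) * (x * n * n * n ^ k)"
        using x by (intro mult_le_mono power_mono) auto
      also have "\<dots> \<le> n ^ k * (x * n * n * n ^ k)"
        using t by (intro mult_le_mono1) (simp add: k)
      also have "\<dots> = x * n\<^sup>2 ^ r"
        by (simp add: k power2_eq_square power_mult_distrib ac_simps)
      finally show ?thesis .
    qed
    have "card (Bad x) * (x * n\<^sup>2 ^ r) ^ x * 2 ^ x \<le> card C * (6 * n * (x * M) ^ r) ^ x * 2 ^ x"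
      using c2 by (rule mult_le_mono1)
    also have "\<dots> = card C * (2 * (6 * n * (x * M) ^ r)) ^ x"
      by (subst power_mult_distrib[of 2]) (simp only: ac_simps)
    also have "\<dots> \<le> card C * (x * n\<^sup>2 ^ r) ^ x"
      using c3 by (intro mult_le_mono2 power_mono) auto
    finally have "(card (Bad x) * 2 ^ x) * (x * n\<^sup>2 ^ r) ^ x \<le> card C * (x * n\<^sup>2 ^ r) ^ x"
      by (simp only: ac_simps)
    moreover have "0 < (x * n\<^sup>2 ^ r) ^ x" using x n by simp
    ultimately have "card (Bad x) * 2 ^ x \<le> card C" using mult_le_cancel2 by blast
    then have "real (card (Bad x)) * 2 ^ x \<le> real (card C)"
      by (metis of_nat_le_iff of_nat_mult of_nat_numeral of_nat_power)
    then show ?thesis by (simp add: field_simps)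
  qed
  have "real (card (\<Union>x\<in>{1..t}. Bad x)) \<le> real (\<Sum>x\<in>{1..t}. card (Bad x))"
    by (intro of_nat_mono card_UN_le) simp
  also have "\<dots> \<le> (\<Sum>x\<in>{1..t}. card C * (1 / 2) ^ x)"
    unfolding of_nat_sum using bad_le by (rule sum_mono)
  also have "\<dots> = card C * (\<Sum>x\<in>{1..t}. (1 / 2) ^ x)" by (simp add: sum_distrib_left)
  also have "(\<Sum>x\<in>{1..t}. (1 / 2) ^ x) = 1 - (1 / 2 :: real) ^ t"
    by (induction t) auto
  also have "card C * (1 - (1 / 2 :: real) ^ t) < card C" using cCpos by (simp add: algebra_simps)
  finally have "card (\<Union>x\<in>{1..t}. Bad x) < card C" by simp
  moreover have "finite (\<Union>x\<in>{1..t}. Bad x)"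
    by (rule finite_subset[OF _ finC]) (auto simp: Bad_def bad_def)
  ultimately have "\<not> C \<subseteq> (\<Union>x\<in>{1..t}. Bad x)" using card_mono leD by blast
  then obtain E where E: "E \<in> C" "E \<notin> (\<Union>x\<in>{1..t}. Bad x)" by blast
  have "sparse r t E"
    unfolding sparse_def
  proof (intro allI impI, elim conjE)
    fix X :: "nat set" assume X: "finite X" "X \<noteq> {}" "card X \<le> t"
    let ?Y = "X \<inter> {..<2 * n}"
    have eq: "E \<inter> X \<times> X = E \<inter> ?Y \<times> ?Y" using E by (auto simp: C_def U_def)
    have le: "card ?Y \<le> card X" using X by (simp add: card_mono)
    show "card (E \<inter> X \<times> X) < r * card X"
    proof (cases "?Y = {}")
      case True
      then show ?thesis unfolding eq using X r by (simp add: card_gt_0_iff)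
    next
      case False
      then have "card ?Y \<in> {1..t}" using X le by (auto simp: Suc_le_eq card_gt_0_iff)
      then have "E \<notin> bad (card ?Y) ?Y" using E by (auto simp: Bad_def)
      then have "card (E \<inter> ?Y \<times> ?Y) < r * card ?Y" using E by (simp add: bad_def)
      also have "\<dots> \<le> r * card X" using le by simp
      finally show ?thesis unfolding eq .
    qed
  qed
  then show thesis using that E by (auto simp: C_def U_def M_def)
qed

section \<open>Choosability of locally sparse bipartite graphs\<close>

definition nbrs :: "('a \<times> 'a) set \<Rightarrow> 'a \<Rightarrow> 'a set" where
  "nbrs E v = {u. (u, v) \<in> E \<or> (v, u) \<in> E}"

lemma sum_binomial_le_power:
  assumes "2 \<le> s"
  shows "(\<Sum>i<k. s choose i) \<le> s ^ k"
proof (induction k)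
  case (Suc k)
  have "s choose k \<le> s ^ k"
    by (metis binomial_eq_0_iff binomial_le_pow le_less_linear zero_le)
  then have "(\<Sum>i<Suc k. s choose i) \<le> 2 * s ^ k" using Suc by simp
  also have "\<dots> \<le> s ^ Suc k" using assms by simp
  finally show ?case .
qed simp

text \<open>
  A uniformly random \<open>S \<subseteq> P\<close> contains fewer than \<open>k\<close> elements of the list \<open>L\<close> with probability at most
  \<open>s ^ k / 2 ^ s\<close>: the trace of \<open>S\<close> on \<open>L\<close> is a uniformly random subset of \<open>L\<close>.
\<close>

lemma card_small_intersection_le:
  assumes "finite P" "L \<subseteq> P" "card L = s" "2 \<le> s"
  shows "card {S \<in> Pow P. card (L \<inter> S) < k} * 2 ^ s \<le> s ^ k * 2 ^ card P"
proof -
  have finL: "finite L" using assms finite_subset by blast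
  let ?T = "{T. T \<subseteq> L \<and> card T < k}"
  have "{S \<in> Pow P. card (L \<inter> S) < k} \<subseteq> (\<lambda>(T, R). T \<union> R) ` (?T \<times> Pow (P - L))"
  proof
    fix S assume S: "S \<in> {S \<in> Pow P. card (L \<inter> S) < k}"
    then have "(L \<inter> S, S - L) \<in> ?T \<times> Pow (P - L)" "S = (\<lambda>(T, R). T \<union> R) (L \<inter> S, S - L)"
      by auto
    then show "S \<in> (\<lambda>(T, R). T \<union> R) ` (?T \<times> Pow (P - L))" by blast
  qed
  then have "card {S \<in> Pow P. card (L \<inter> S) < k} \<le> card (?T \<times> Pow (P - L))"
    by (rule surj_card_le[rotated]) (simp add: finL assms(1))
  also have "\<dots> = card ?T * 2 ^ (card P - s)"
    using assms finL by (simp add: card_cartesian_product card_Pow card_Diff_subset)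
  finally have 1: "card {S \<in> Pow P. card (L \<inter> S) < k} \<le> card ?T * 2 ^ (card P - s)" .
  have "?T = (\<Union>i<k. {T. T \<subseteq> L \<and> card T = i})" by auto
  then have "card ?T \<le> (\<Sum>i<k. card {T. T \<subseteq> L \<and> card T = i})"
    using card_UN_le[of "{..<k}" "\<lambda>i. {T. T \<subseteq> L \<and> card T = i}"] by simp
  also have "\<dots> \<le> s ^ k"
    using sum_binomial_le_power[OF assms(4)] by (simp add: n_subsets finL assms(3))
  finally have 2: "card ?T \<le> s ^ k" .
  have "s \<le> card P" using assms card_mono by blast
  then have "s ^ k * 2 ^ (card P - s) * 2 ^ s = s ^ k * 2 ^ card P"
    by (simp add: power_add[symmetric])
  moreover have "card {S \<in> Pow P. card (L \<inter> S) < k} \<le> s ^ k * 2 ^ (card P - s)"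
    using 1 2 by (meson le_trans mult_le_mono1)
  ultimately show ?thesis by (metis mult_le_mono1)
qed

text \<open>
  The colours in \<open>S\<close> are reserved for \<open>A\<close>, all others for \<open>B\<close>. Averaged over all splits of the palette,
  the number of vertices that retain fewer than \<open>k\<close> colours is at most \<open>u\<close>, so some split achieves \<open>u\<close>.
\<close>

lemma exists_palette_split:
  fixes L :: "'a \<Rightarrow> 'c set"
  assumes fin: "finite A" "finite B" and disj: "A \<inter> B = {}"
    and L: "\<And>v. v \<in> A \<union> B \<Longrightarrow> finite (L v) \<and> card (L v) = s"
    and s: "2 \<le> s"
    and u: "card (A \<union> B) * s ^ k \<le> u * 2 ^ s"
  obtains S where "card ({v \<in> A. card (L v \<inter> S) < k} \<union> {v \<in> B. card (L v - S) < k}) \<le> u"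
proof -
  define V where "V = A \<union> B"
  define P where "P = (\<Union>v\<in>V. L v)"
  have finV: "finite V" using fin by (simp add: V_def)
  have finP: "finite P" using finV L by (simp add: P_def V_def)
  have LP: "L v \<subseteq> P" if "v \<in> V" for v using that by (auto simp: P_def)
  define bad where "bad = (\<lambda>S. {v \<in> A. card (L v \<inter> S) < k} \<union> {v \<in> B. card (L v - S) < k})"
  have badV: "bad S \<subseteq> V" for S by (auto simp: bad_def V_def)
  have one: "card {S \<in> Pow P. v \<in> bad S} * 2 ^ s \<le> s ^ k * 2 ^ card P" if v: "v \<in> V" for v
  proof (cases "v \<in> A")
    case True
    then have "{S \<in> Pow P. v \<in> bad S} = {S \<in> Pow P. card (L v \<inter> S) < k}"
      using disj by (auto simp: bad_def)
    then show ?thesis using card_small_intersection_le[OF finP LP[OF v]] L v s by (simp add: V_def)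
  next
    case False
    have eq: "L v \<inter> (P - S) = L v - S" for S using LP[OF v] by auto
    have "{S \<in> Pow P. v \<in> bad S} \<subseteq> (\<lambda>S. P - S) ` {S \<in> Pow P. card (L v \<inter> S) < k}"
    proof
      fix S assume S: "S \<in> {S \<in> Pow P. v \<in> bad S}"
      then have "P - S \<in> {S \<in> Pow P. card (L v \<inter> S) < k}" "S = P - (P - S)"
        using False by (auto simp: bad_def eq)
      then show "S \<in> (\<lambda>S. P - S) ` {S \<in> Pow P. card (L v \<inter> S) < k}" by blast
    qed
    then have "card {S \<in> Pow P. v \<in> bad S} \<le> card {S \<in> Pow P. card (L v \<inter> S) < k}"
      by (rule surj_card_le[rotated]) (simp add: finP)
    moreover have "card {S \<in> Pow P. card (L v \<inter> S) < k} * 2 ^ s \<le> s ^ k * 2 ^ card P"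
      using card_small_intersection_le[OF finP LP[OF v]] L v s by (simp add: V_def)
    ultimately show ?thesis by (meson le_trans mult_le_mono1)
  qed
  have "(\<Sum>S\<in>Pow P. card (bad S)) = (\<Sum>v\<in>V. card {S \<in> Pow P. v \<in> bad S})"
  proof -
    have "(\<Sum>S\<in>Pow P. card {v \<in> V. v \<in> bad S}) = (\<Sum>v\<in>V. card {S \<in> Pow P. v \<in> bad S})"
      using finP finV sum_multicount_gen[of "Pow P" V "\<lambda>S v. v \<in> bad S" "\<lambda>v. card {S \<in> Pow P. v \<in> bad S}"]
      by simp
    moreover have "{v \<in> V. v \<in> bad S} = bad S" for S using badV by auto
    ultimately show ?thesis by simp
  qed
  then have "(\<Sum>S\<in>Pow P. card (bad S)) * 2 ^ s = (\<Sum>v\<in>V. card {S \<in> Pow P. v \<in> bad S} * 2 ^ s)"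
    by (simp only: sum_distrib_right)
  also have "\<dots> \<le> (\<Sum>v\<in>V. s ^ k * 2 ^ card P)" using one by (rule sum_mono)
  also have "\<dots> = (card V * s ^ k) * 2 ^ card P" by simp
  also have "\<dots> \<le> (u * 2 ^ s) * 2 ^ card P" using u by (intro mult_le_mono1) (simp add: V_def)
  also have "\<dots> = (u * 2 ^ card P) * 2 ^ s" by simp
  finally have avg: "(\<Sum>S\<in>Pow P. card (bad S)) \<le> u * 2 ^ card P" by simp
  have "\<exists>S\<in>Pow P. card (bad S) \<le> u"
  proof (rule ccontr)
    assume "\<not> ?thesis"
    then have "\<And>S. S \<in> Pow P \<Longrightarrow> u + 1 \<le> card (bad S)" by (auto simp: not_le Suc_le_eq)
    then have "(\<Sum>S\<in>Pow P. u + 1) \<le> (\<Sum>S\<in>Pow P. card (bad S))" by (rule sum_mono)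
    then have "2 ^ card P * (u + 1) \<le> u * 2 ^ card P"
      using avg by (simp only: sum_constant card_Pow finP of_nat_id)
    then have "2 ^ card P + u * 2 ^ card P \<le> u * 2 ^ card P" by (simp add: algebra_simps)
    moreover have "0 < (2 :: nat) ^ card P" by simp
    ultimately show False by linarith
  qed
  then show thesis using that by (auto simp: bad_def)
qed

text \<open>
  An inequality and not an equation, since a relation may contain both orientations of an edge.
\<close>

lemma card_nbrs_in_le:
  assumes "finite E" "v \<notin> X"
  shows "card (nbrs E v \<inter> X) \<le> card (E \<inter> insert v X \<times> insert v X - E \<inter> X \<times> X)"
proof -
  let ?f = "\<lambda>(a, b). if a = v then b else a"
  have "nbrs E v \<inter> X \<subseteq> ?f ` (E \<inter> insert v X \<times> insert v X - E \<inter> X \<times> X)"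
  proof
    fix u assume u: "u \<in> nbrs E v \<inter> X"
    then have "u \<noteq> v" using assms by auto
    consider "(u, v) \<in> E" | "(v, u) \<in> E" using u by (auto simp: nbrs_def)
    then show "u \<in> ?f ` (E \<inter> insert v X \<times> insert v X - E \<inter> X \<times> X)"
    proof cases
      case 1
      then show ?thesis using u assms(2) \<open>u \<noteq> v\<close> by (intro image_eqI[of _ _ "(u, v)"]) auto
    next
      case 2
      then show ?thesis using u assms(2) \<open>u \<noteq> v\<close> by (intro image_eqI[of _ _ "(v, u)"]) auto
    qed
  qed
  then show ?thesis by (rule surj_card_le[rotated]) (simp add: assms(1))
qed

lemma sum_card_nbrs_in_le:
  assumes "finite E" "finite X"
  shows "(\<Sum>v\<in>X. card (nbrs E v \<inter> X)) \<le> 2 * card (E \<inter> X \<times> X)"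
proof -
  let ?F = "E \<inter> X \<times> X"
  have "(\<Sum>v\<in>X. card (nbrs E v \<inter> X)) = card (SIGMA v:X. nbrs E v \<inter> X)"
    using assms by (simp add: card_SigmaI)
  also have "\<dots> \<le> card (?F \<union> ?F\<inverse>)"
  proof (rule card_mono)
    show "finite (?F \<union> ?F\<inverse>)" using assms by simp
    show "(SIGMA v:X. nbrs E v \<inter> X) \<subseteq> ?F \<union> ?F\<inverse>"
      by (auto simp: nbrs_def)
  qed
  also have "\<dots> \<le> card ?F + card (?F\<inverse>)" by (rule card_Un_le)
  also have "\<dots> \<le> 2 * card ?F" by (simp add: card_inverse)
  finally show ?thesis .
qed

text \<open>
  \<open>X\<close> is a maximal set that arises from \<open>U\<close> by adding vertices each bringing at least \<open>2 * r\<close> new edges.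
  Its edge count of at least \<open>2 * r * (card X - card U)\<close> is compatible with sparsity only if
  \<open>card X < 2 * card U\<close>, so the process stops for lack of vertices with many neighbours, not because
  it reaches the size bound.
\<close>

lemma sparse_closure:
  assumes r: "0 < r" and E: "sparse r t E" "finite E" and V: "finite V" and U: "U \<subseteq> V" "2 * card U \<le> t"
  obtains X where "U \<subseteq> X" "X \<subseteq> V" "card X \<le> t" "\<And>v. v \<in> V - X \<Longrightarrow> card (nbrs E v \<inter> X) < 2 * r"
proof -
  let ?P = "\<lambda>X. U \<subseteq> X \<and> X \<subseteq> V \<and> card X \<le> 2 * card U \<and>
    2 * r * card X \<le> card (E \<inter> X \<times> X) + 2 * r * card U"
  have "finite {X. ?P X}" by (rule finite_subset[of _ "Pow V"]) (use V in auto)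
  moreover have PU: "?P U" using U by simp
  have "{X. ?P X} \<noteq> {}" using PU by (rule ex_in_conv[THEN iffD1, OF exI, OF CollectI])
  ultimately have "\<exists>X\<in>{X. ?P X}. \<forall>Y\<in>{X. ?P X}. X \<subseteq> Y \<longrightarrow> X = Y"
    by (rule finite_has_maximal)
  then obtain X where "X \<in> {X. ?P X}" and max: "\<forall>Y\<in>{X. ?P X}. X \<subseteq> Y \<longrightarrow> X = Y"
    by (rule bexE)
  then have X: "?P X" by simp
  have finX: "finite X" using X V finite_subset by blast
  have few: "card (nbrs E v \<inter> X) < 2 * r" if v: "v \<in> V - X" for v
  proof (rule ccontr)
    assume "\<not> ?thesis"
    then have many: "2 * r \<le> card (nbrs E v \<inter> X)" by simp
    let ?Y = "insert v X"
    have "card (E \<inter> ?Y \<times> ?Y - E \<inter> X \<times> X) = card (E \<inter> ?Y \<times> ?Y) - card (E \<inter> X \<times> X)"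
      by (rule card_Diff_subset) (use E(2) in auto)
    then have edges: "card (E \<inter> X \<times> X) + 2 * r \<le> card (E \<inter> ?Y \<times> ?Y)"
      using card_nbrs_in_le[OF E(2), of v X] v many r by simp
    have small: "card X < 2 * card U"
    proof -
      have "X \<noteq> {}" using many r by auto
      then have "card (E \<inter> X \<times> X) < r * card X"
        using E(1) X U(2) finX unfolding sparse_def by auto
      then have "2 * r * card X < r * card X + 2 * r * card U" using X by linarith
      then have "r * card X < r * (2 * card U)" by simp
      then show ?thesis by simp
    qed
    have "?P ?Y" using X v edges small finX by (auto simp: algebra_simps)
    then have "X = ?Y" using max by blast
    then show False using v by blast
  qed
  show thesis by (rule that[of X]) (use X U few in auto)
qed

text \<open>
  Sparsity makes the average degree of every nonempty subset of \<open>X\<close> less than \<open>2 * r\<close>, so some vertex has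
  fewer than \<open>2 * r\<close> neighbours in it and can be coloured last.
\<close>

lemma sparse_list_colorable:
  assumes E: "sparse r t E" "finite E" "irrefl E" and X: "finite X" "card X \<le> t"
    and L: "\<And>v. v \<in> X \<Longrightarrow> finite (L v) \<and> 2 * r \<le> card (L v)"
  shows "\<exists>\<phi>. (\<forall>v\<in>X. \<phi> v \<in> L v) \<and> (\<forall>u\<in>X. \<forall>v\<in>X. (u, v) \<in> E \<longrightarrow> \<phi> u \<noteq> \<phi> v)"
  using X L
proof (induction X rule: finite_psubset_induct)
  case (psubset X)
  show ?case
  proof (cases "X = {}")
    case False
    obtain v where v: "v \<in> X" "card (nbrs E v \<inter> X) < 2 * r"
    proof (rule ccontr)
      assume "\<not> thesis"
      then have "\<And>v. v \<in> X \<Longrightarrow> 2 * r \<le> card (nbrs E v \<inter> X)" using that by (meson not_le)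
      then have "(\<Sum>v\<in>X. 2 * r) \<le> (\<Sum>v\<in>X. card (nbrs E v \<inter> X))" by (rule sum_mono)
      then have "2 * (r * card X) \<le> (\<Sum>v\<in>X. card (nbrs E v \<inter> X))" by (simp add: ac_simps)
      also have "\<dots> \<le> 2 * card (E \<inter> X \<times> X)"
        using sum_card_nbrs_in_le[OF E(2)] psubset.hyps by blast
      finally have "r * card X \<le> card (E \<inter> X \<times> X)" by simp
      then show False using E(1) False psubset unfolding sparse_def by (meson leD)
    qed
    let ?X = "X - {v}"
    have "card ?X \<le> t" using psubset.prems(1) by (meson card_Diff1_le le_trans)
    then obtain \<phi> where \<phi>: "\<forall>v\<in>?X. \<phi> v \<in> L v"
      "\<forall>u\<in>?X. \<forall>v\<in>?X. (u, v) \<in> E \<longrightarrow> \<phi> u \<noteq> \<phi> v"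
      using psubset.IH[of ?X] psubset.prems v(1) by blast
    have "card (\<phi> ` (nbrs E v \<inter> X)) < card (L v)"
      using card_image_le[of "nbrs E v \<inter> X" \<phi>] psubset.hyps psubset.prems(2)[OF v(1)] v(2)
      by simp
    then have "\<not> L v \<subseteq> \<phi> ` (nbrs E v \<inter> X)"
      using psubset.hyps by (meson card_mono finite_Int finite_imageI leD)
    then obtain c where c: "c \<in> L v" "c \<notin> \<phi> ` (nbrs E v \<inter> X)" by blast
    have "(v, v) \<notin> E" using E(3) by (auto simp: irrefl_def)
    then have "(\<forall>w\<in>X. (\<phi>(v := c)) w \<in> L w) \<and>
      (\<forall>u\<in>X. \<forall>w\<in>X. (u, w) \<in> E \<longrightarrow> (\<phi>(v := c)) u \<noteq> (\<phi>(v := c)) w)"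
      using \<phi> c by (auto simp: nbrs_def)
    then show ?thesis by blast
  qed simp
qed

text \<open>
  The exceptional set \<open>X\<close> is coloured from the full lists, ignoring the split of the palette. Every other
  vertex uses a colour reserved for its side, so that conflicts can only arise with \<open>X\<close>.
\<close>

theorem sparse_bipartite_choosable:
  fixes L :: "'a \<Rightarrow> 'c set"
  assumes fin: "finite A" "finite B" and disj: "A \<inter> B = {}"
    and E: "E \<subseteq> A \<times> B" "sparse r t E"
    and r: "0 < r" "2 * r \<le> s"
    and u: "card (A \<union> B) * s ^ (2 * r) \<le> u * 2 ^ s" "2 * u \<le> t"
    and L: "\<And>v. v \<in> A \<union> B \<Longrightarrow> finite (L v) \<and> card (L v) = s"
  obtains \<phi> where "\<And>v. v \<in> A \<union> B \<Longrightarrow> \<phi> v \<in> L v" "\<And>a b. (a, b) \<in> E \<Longrightarrow> \<phi> a \<noteq> \<phi> b"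
proof -
  have finE: "finite E" using E(1) fin finite_subset by blast
  have irr: "irrefl E" using E(1) disj by (auto simp: irrefl_def)
  obtain S where S: "card ({v \<in> A. card (L v \<inter> S) < 2 * r} \<union> {v \<in> B. card (L v - S) < 2 * r}) \<le> u"
    (is "card ?U \<le> u")
    using exists_palette_split[of A B L s "2 * r" u] fin disj L r u(1) by auto
  obtain X where X: "?U \<subseteq> X" "X \<subseteq> A \<union> B" "card X \<le> t"
    and few: "\<And>v. v \<in> A \<union> B - X \<Longrightarrow> card (nbrs E v \<inter> X) < 2 * r"
    using sparse_closure[OF r(1) E(2) finE, of "A \<union> B" ?U] fin S u(2) by auto
  have finX: "finite X" using X fin finite_subset by blast
  obtain \<psi> where \<psi>: "\<forall>v\<in>X. \<psi> v \<in> L v" "\<forall>u\<in>X. \<forall>v\<in>X. (u, v) \<in> E \<longrightarrow> \<psi> u \<noteq> \<psi> v"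
    using sparse_list_colorable[OF E(2) finE irr finX X(3), of L] L X(2) r(2) by blast
  define Q where "Q = (\<lambda>v. if v \<in> A then L v \<inter> S else L v - S)"
  have "\<exists>c. c \<in> Q v \<and> c \<notin> \<psi> ` (nbrs E v \<inter> X)" if v: "v \<in> A \<union> B - X" for v
  proof -
    have "2 * r \<le> card (Q v)" using v X(1) disj by (auto simp: Q_def not_less)
    moreover have "card (\<psi> ` (nbrs E v \<inter> X)) < 2 * r"
      using card_image_le[of "nbrs E v \<inter> X" \<psi>] few[OF v] finX by simp
    ultimately have "\<not> Q v \<subseteq> \<psi> ` (nbrs E v \<inter> X)"
      using finX by (meson card_mono finite_Int finite_imageI leD le_less_trans less_le_trans)
    then show ?thesis by blast
  qed
  then obtain \<theta> where \<theta>: "\<And>v. v \<in> A \<union> B - X \<Longrightarrow> \<theta> v \<in> Q v \<and> \<theta> v \<notin> \<psi> ` (nbrs E v \<inter> X)"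
    using bchoice[of "A \<union> B - X" "\<lambda>v c. c \<in> Q v \<and> c \<notin> \<psi> ` (nbrs E v \<inter> X)"] by blast
  define \<phi> where "\<phi> = (\<lambda>v. if v \<in> X then \<psi> v else \<theta> v)"
  show thesis
  proof (rule that[of \<phi>])
    fix v assume "v \<in> A \<union> B"
    then show "\<phi> v \<in> L v" using \<psi>(1) \<theta>[of v] by (auto simp: \<phi>_def Q_def split: if_splits)
  next
    fix a b assume ab: "(a, b) \<in> E"
    then have "a \<in> A" "b \<in> B" "b \<notin> A" using E(1) disj by auto
    moreover have "b \<in> nbrs E a" "a \<in> nbrs E b" using ab by (auto simp: nbrs_def)
    ultimately have nbr: "a \<in> nbrs E b" "b \<in> nbrs E a" and Q: "Q a \<inter> Q b = {}" "a \<in> A \<union> B" "b \<in> A \<union> B"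
      by (auto simp: Q_def)
    consider "a \<in> X" "b \<in> X" | "a \<in> X" "b \<notin> X" | "a \<notin> X" "b \<in> X" | "a \<notin> X" "b \<notin> X" by blast
    then show "\<phi> a \<noteq> \<phi> b"
    proof cases
      case 1
      then show ?thesis using \<psi>(2) ab by (simp add: \<phi>_def)
    next
      case 2
      then show ?thesis using \<theta>[of b] nbr Q by (force simp: \<phi>_def)
    next
      case 3
      then show ?thesis using \<theta>[of a] nbr Q by (force simp: \<phi>_def)
    next
      case 4
      then have "\<theta> a \<in> Q a" "\<theta> b \<in> Q b" using \<theta> Q by auto
      then show ?thesis using 4 Q by (auto simp: \<phi>_def)
    qed
  qed
qed

section \<open>Components of symmetric digraphs\<close>

text \<open>
  Components are determined by their vertex sets, which are easier to handle than subgraphs.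
\<close>

lemma star_order_conv:
  assumes "wf_digraph G"
  shows "star_order G = Max (insert 0 (card ` pre_digraph.sccs_verts G))"
  unfolding star_order_def wf_digraph.sccs_verts_conv[OF assms] by (simp add: image_image)

lemma star_order_le_1_if_no_arcs:
  assumes "fin_digraph G" "arcs G = {}"
  shows "star_order G \<le> 1"
proof -
  interpret fin_digraph G by fact
  have "card C \<le> 1" if C: "C \<in> sccs_verts" for C
  proof -
    have "u = v" if "u \<rightarrow>\<^sup>*\<^bsub>G\<^esub> v" for u v
      using that by (cases rule: converse_reachable_cases) (auto simp: arcs_ends_def assms(2))
    then have "\<forall>u\<in>C. \<forall>v\<in>C. u = v" using C by (auto simp: sccs_verts_def)
    then show ?thesis by (metis One_nat_def card_le_Suc0_iff_eq card.infinite zero_le)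
  qed
  then show ?thesis using finite_sccs_verts by (subst star_order_conv) (auto simp: wf_digraph)
qed

lemma star_order_component:
  assumes "pseudo_graph G" "v \<in> verts G"
  obtains C where "v \<in> C" "C \<subseteq> verts G" "card C \<le> star_order G"
    "\<And>u w. u \<in> C \<Longrightarrow> u \<rightarrow>\<^bsub>G\<^esub> w \<Longrightarrow> w \<in> C"
proof -
  interpret pseudo_graph G by fact
  have scc: "scc_of v \<in> sccs_verts" using assms(2) by (rule scc_of_in_sccs_verts)
  show thesis
  proof (rule that[of "scc_of v"])
    show "v \<in> scc_of v" using assms(2) by (rule in_scc_of_self)
    show "scc_of v \<subseteq> verts G" using scc by (rule sccs_verts_subsets)
    show "card (scc_of v) \<le> star_order G"
      using scc finite_sccs_verts by (subst star_order_conv) (auto simp: wf_digraph intro!: Max_ge)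
    fix u w assume "u \<in> scc_of v" "u \<rightarrow>\<^bsub>G\<^esub> w"
    then have "v \<rightarrow>\<^sup>*\<^bsub>G\<^esub> w" unfolding scc_of_def by (blast intro: reachable_adj_trans)
    then show "w \<in> scc_of v" unfolding scc_of_def by (auto intro: symmetric_reachable')
  qed
qed

section \<open>Graphs given by an orientation of their edges\<close>

definition graph_of :: "'a set \<Rightarrow> ('a \<times> 'a) set \<Rightarrow> 'a pair_pre_digraph" where
  "graph_of V E = \<lparr> pverts = V, parcs = E \<union> E\<inverse> \<rparr>"

lemma pair_graph_graph_of:
  assumes "finite V" "E \<subseteq> V \<times> V" "irrefl E"
  shows "pair_graph (graph_of V E)"
proof -
  have "finite E" using assms finite_subset by blast
  then show ?thesis using assms
    by unfold_locales
      (auto simp: graph_of_def symmetric_def irrefl_def intro: symI)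
qed

lemma induce_graph_of_simps:
  "verts (with_proj (graph_of V E) \<restriction> S) = S"
  "arcs_ends (with_proj (graph_of V E) \<restriction> S) = (E \<union> E\<inverse>) \<inter> S \<times> S"
  "S \<subseteq> X \<Longrightarrow> (with_proj (graph_of V E) \<restriction> X) \<restriction> S = with_proj (graph_of V E) \<restriction> S"
  by (auto simp: graph_of_def induce_subgraph_def arcs_ends_conv image_iff)

lemma pseudo_graph_induce_graph_of:
  assumes "finite S"
  shows "pseudo_graph (with_proj (graph_of V E) \<restriction> S)"
proof -
  have "arcs (with_proj (graph_of V E) \<restriction> S) \<subseteq> S \<times> S" by (auto simp: graph_of_def)
  then have "finite (arcs (with_proj (graph_of V E) \<restriction> S))"
    using assms finite_subset by blast
  moreover have "symmetric (with_proj (graph_of V E) \<restriction> S)"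
    unfolding symmetric_def induce_graph_of_simps by (auto intro: symI)
  ultimately show ?thesis using assms by unfold_locales auto
qed

text \<open>
  Colour classes of a proper colouring span no arcs and so have components of order 1. Larger or infinite
  lists may be shrunk to size exactly \<open>s\<close>.
\<close>

lemma clustered_choosability_one_le:
  fixes E :: "('a \<times> 'a) set"
  assumes V: "finite V" "E \<subseteq> V \<times> V" "irrefl E"
    and col: "\<And>L :: 'a \<Rightarrow> nat set. (\<And>v. v \<in> V \<Longrightarrow> finite (L v) \<and> card (L v) = s) \<Longrightarrow>
      \<exists>\<phi>. (\<forall>v\<in>V. \<phi> v \<in> L v) \<and> (\<forall>(u, v)\<in>E. \<phi> u \<noteq> \<phi> v)"
  shows "clustered_choosability 1 (with_proj (graph_of V E)) \<le> enat s"
proof -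
  let ?G = "with_proj (graph_of V E)"
  interpret pair_graph "graph_of V E" using V by (rule pair_graph_graph_of)
  have "\<exists>\<phi>. list_coloring ?G L \<phi> \<and>
      (\<forall>c \<in> \<phi> ` verts ?G. star_order (?G \<restriction> {v \<in> verts ?G. \<phi> v = c}) \<le> 1)"
    if L: "list_assignment ?G s L" for L :: "'a \<Rightarrow> nat set"
  proof -
    have "\<exists>K. K \<subseteq> L v \<and> finite K \<and> card K = s" if "v \<in> V" for v
    proof (cases "finite (L v)")
      case True
      then have "s \<le> card (L v)" using L that by (auto simp: list_assignment_def graph_of_def)
      then show ?thesis by (meson obtain_subset_with_card_n)
    next
      case False
      then show ?thesis by (meson infinite_arbitrarily_large)
    qed
    then obtain K where K: "\<And>v. v \<in> V \<Longrightarrow> K v \<subseteq> L v \<and> finite (K v) \<and> card (K v) = s"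
      by metis
    then obtain \<phi> where \<phi>: "\<forall>v\<in>V. \<phi> v \<in> K v" "\<forall>(u, v)\<in>E. \<phi> u \<noteq> \<phi> v"
      using col[of K] by blast
    have "list_coloring ?G L \<phi>" using \<phi>(1) K by (fastforce simp: list_coloring_def graph_of_def)
    moreover have "star_order (?G \<restriction> {v \<in> verts ?G. \<phi> v = c}) \<le> 1" for c
    proof (rule star_order_le_1_if_no_arcs)
      show "fin_digraph (?G \<restriction> {v \<in> verts ?G. \<phi> v = c})"
        using V(1) pseudo_graph_induce_graph_of[of "{v \<in> V. \<phi> v = c}" V E]
        by (simp add: pseudo_graph_def graph_of_def)
      show "arcs (?G \<restriction> {v \<in> verts ?G. \<phi> v = c}) = {}"
        using \<phi> by (auto simp: graph_of_def induce_subgraph_def)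
    qed
    ultimately show ?thesis by blast
  qed
  then show ?thesis unfolding clustered_choosability_def by (intro Inf_lower) blast
qed

text \<open>
  The infimum defining \<^const>\<open>clustered_col\<close> is attained if it is finite, and islands for a smaller
  bound are islands for \<open>s\<close>.
\<close>

lemma clustered_col_leD:
  assumes "clustered_col p G \<le> enat s" "induced_subgraph H G" "verts H \<noteq> {}"
  obtains I where "island H s I" "star_order (H \<restriction> I) \<le> p"
proof -
  let ?S = "{enat s | s. 0 < s \<and>
     (\<forall>H. induced_subgraph H G \<and> verts H \<noteq> {} \<longrightarrow>
       (\<exists>I. island H s I \<and> star_order (H \<restriction> I) \<le> p))}"
  have ne: "?S \<noteq> {}"
  proof
    assume "?S = {}"
    then have "clustered_col p G = Inf {}" unfolding clustered_col_def by (rule arg_cong)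
    then have "clustered_col p G = \<infinity>" by (simp add: Inf_enat_def)
    with assms(1) show False by simp
  qed
  then obtain x where "x \<in> ?S" by blast
  then have "(LEAST x. x \<in> ?S) \<in> ?S" by (rule LeastI)
  then have "Inf ?S \<in> ?S" unfolding Inf_enat_def if_not_P[OF ne] .
  then obtain s0 where s0: "clustered_col p G = enat s0"
    and isl: "\<forall>H. induced_subgraph H G \<and> verts H \<noteq> {} \<longrightarrow>
       (\<exists>I. island H s0 I \<and> star_order (H \<restriction> I) \<le> p)"
    unfolding clustered_col_def by auto
  then obtain I where I: "island H s0 I" "star_order (H \<restriction> I) \<le> p" using assms by blast
  have "s0 \<le> s" using s0 assms(1) by simp
  then have "island H s I" using I(1) unfolding island_def by (meson less_le_trans)
  then show thesis using I(2) that by blast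
qed

section \<open>Islands in dense locally sparse graphs\<close>

text \<open>
  By minimality of \<open>X\<close>, removing \<open>C\<close> destroys at least \<open>d * card C\<close> edges. Fewer than \<open>r * card C\<close> of
  these lie inside \<open>C\<close>, so that at least \<open>(d - r) * card C\<close> of them join \<open>C\<close> to \<open>X - C\<close>.
\<close>

lemma dense_sparse_expanding:
  assumes E: "sparse r t E" "finite E" "asym E" and X: "finite X"
    and min: "\<And>Y. Y \<subset> X \<Longrightarrow> Y \<noteq> {} \<Longrightarrow> card (E \<inter> Y \<times> Y) < d * card Y"
    and dense: "d * card X \<le> card (E \<inter> X \<times> X)"
    and C: "C \<subseteq> X" "C \<noteq> {}" "card C \<le> t"
    and m: "m + r \<le> d"
  shows "\<exists>v\<in>C. m \<le> card (nbrs E v \<inter> (X - C))"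
proof (rule ccontr)
  assume "\<not> ?thesis"
  then have few: "card (nbrs E v \<inter> (X - C)) \<le> m" if "v \<in> C" for v using that by force
  have finC: "finite C" using C X finite_subset by blast
  let ?Y = "X - C"
  let ?e = "\<lambda>(v, u). if (v, u) \<in> E then (v, u) else (u, v)"
  have "E \<inter> X \<times> X \<subseteq> (E \<inter> ?Y \<times> ?Y) \<union> (E \<inter> C \<times> C) \<union> ?e ` (SIGMA v:C. nbrs E v \<inter> ?Y)"
  proof
    fix p assume p: "p \<in> E \<inter> X \<times> X"
    obtain a b where ab: "p = (a, b)" by (cases p)
    \<comment> \<open>By asymmetry, \<open>?e\<close> recovers the orientation of each edge between \<open>C\<close> and the rest.\<close>
    have "(b, a) \<notin> E" using p ab E(3) by (auto dest: asymD)
    have "p \<in> ?e ` (SIGMA v:C. nbrs E v \<inter> ?Y)" if "a \<in> C" "b \<notin> C"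
      by (rule image_eqI[of _ _ "(a, b)"]) (use that p ab in \<open>auto simp: nbrs_def\<close>)
    moreover have "p \<in> ?e ` (SIGMA v:C. nbrs E v \<inter> ?Y)" if "a \<notin> C" "b \<in> C"
      by (rule image_eqI[of _ _ "(b, a)"]) (use that p ab \<open>(b, a) \<notin> E\<close> in \<open>auto simp: nbrs_def\<close>)
    ultimately show "p \<in> (E \<inter> ?Y \<times> ?Y) \<union> (E \<inter> C \<times> C) \<union> ?e ` (SIGMA v:C. nbrs E v \<inter> ?Y)"
      using p ab by blast
  qed
  then have "card (E \<inter> X \<times> X)
      \<le> card ((E \<inter> ?Y \<times> ?Y) \<union> (E \<inter> C \<times> C) \<union> ?e ` (SIGMA v:C. nbrs E v \<inter> ?Y))"
    by (rule card_mono[rotated]) (use E(2) X finC in auto)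
  also have "\<dots> \<le> card (E \<inter> ?Y \<times> ?Y) + card (E \<inter> C \<times> C) + card (?e ` (SIGMA v:C. nbrs E v \<inter> ?Y))"
    by (meson add_le_mono1 card_Un_le le_trans)
  also have "card (?e ` (SIGMA v:C. nbrs E v \<inter> ?Y)) \<le> card (SIGMA v:C. nbrs E v \<inter> ?Y)"
    by (rule card_image_le) (use X finC in auto)
  also have "\<dots> = (\<Sum>v\<in>C. card (nbrs E v \<inter> ?Y))" using X finC by simp
  also have "\<dots> \<le> card C * m" using sum_bounded_above[of C _ m] few by simp
  finally have "card (E \<inter> X \<times> X) \<le> card (E \<inter> ?Y \<times> ?Y) + card (E \<inter> C \<times> C) + card C * m" by simp
  moreover have "card (E \<inter> ?Y \<times> ?Y) \<le> d * card ?Y"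
  proof (cases "?Y = {}")
    case False
    moreover have "?Y \<subset> X" using C(1,2) by blast
    ultimately show ?thesis using min[of ?Y] by simp
  next
    case True
    show ?thesis unfolding True by simp
  qed
  moreover have "card (E \<inter> C \<times> C) < r * card C" using E(1) C(2,3) finC unfolding sparse_def by simp
  moreover have "d * card X = d * card ?Y + d * card C"
  proof -
    have "card X = card ?Y + card C"
      using C(1) finC card_mono[OF X C(1)] by (simp add: card_Diff_subset)
    then show ?thesis by (simp add: add_mult_distrib2)
  qed
  moreover have "r * card C + card C * m \<le> d * card C"
    using mult_le_mono1[OF m, of "card C"] by (simp add: algebra_simps)
  ultimately show False using dense by linarith
qed

lemma clustered_col_greater:
  assumes V: "finite V" "V \<noteq> {}" "E \<subseteq> V \<times> V" and E: "sparse r t E" "asym E"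
    and dense: "d * card V \<le> card E" and m: "m + r \<le> d" and p: "p \<le> t"
  shows "enat m < clustered_col p (with_proj (graph_of V E))"
proof (rule ccontr)
  let ?G = "with_proj (graph_of V E)"
  assume "\<not> ?thesis"
  then have le: "clustered_col p ?G \<le> enat m" by simp
  have finE: "finite E" using V finite_subset by blast
  have irr: "irrefl E" using E(2) by (auto simp: irrefl_def dest: asymD)
  interpret pair_graph "graph_of V E" using V(1,3) irr by (rule pair_graph_graph_of)
  let ?P = "\<lambda>X. X \<subseteq> V \<and> X \<noteq> {} \<and> d * card X \<le> card (E \<inter> X \<times> X)"
  have "E \<inter> V \<times> V = E" using V(3) by auto
  then have "?P V" using V(2) dense by simp
  then obtain X where X: "?P X" and least: "\<And>Y. ?P Y \<Longrightarrow> card X \<le> card Y"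
    using ex_has_least_nat[of ?P V card] by blast
  have finX: "finite X" using X V finite_subset by blast
  have min: "card (E \<inter> Y \<times> Y) < d * card Y" if "Y \<subset> X" "Y \<noteq> {}" for Y
    using least[of Y] psubset_card_mono[OF finX that(1)] that X by force
  let ?H = "?G \<restriction> X"
  have ind: "induced_subgraph ?H ?G" using X by (intro induced_induce) (auto simp: graph_of_def)
  obtain I where I: "island ?H m I" "star_order (?H \<restriction> I) \<le> p"
    using clustered_col_leD[OF le ind] X by (auto simp: induce_graph_of_simps)
  have IX: "I \<subseteq> X" "I \<noteq> {}" using I(1) by (auto simp: island_def)
  have finI: "finite I" using IX finX finite_subset by blast
  have HI: "?H \<restriction> I = ?G \<restriction> I" using IX by (simp add: induce_graph_of_simps)
  let ?K = "?G \<restriction> I"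
  obtain v where "v \<in> verts ?K" using IX by (auto simp: induce_graph_of_simps)
  then obtain C where C: "v \<in> C" "C \<subseteq> verts ?K" "card C \<le> star_order ?K"
    and closed: "\<And>u w. u \<in> C \<Longrightarrow> u \<rightarrow>\<^bsub>?K\<^esub> w \<Longrightarrow> w \<in> C"
    using star_order_component[OF pseudo_graph_induce_graph_of[OF finI]] by metis
  have CI: "C \<subseteq> I" "card C \<le> p" using C I(2) by (auto simp: HI induce_graph_of_simps)
  have "C \<subseteq> X" "C \<noteq> {}" "card C \<le> t" using CI IX C(1) p by auto
  then obtain w where w: "w \<in> C" "m \<le> card (nbrs E w \<inter> (X - C))"
    using dense_sparse_expanding[OF E(1) finE E(2) finX min _ _ _ _ m, of C] X by auto
  have "nbrs E w \<inter> (X - C) \<subseteq> {u \<in> verts ?H - I. w \<rightarrow>\<^bsub>?H\<^esub> u}"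
    using closed[OF w(1)] w(1) CI(1) IX by (auto simp: nbrs_def induce_graph_of_simps)
  then have "card (nbrs E w \<inter> (X - C)) \<le> card {u \<in> verts ?H - I. w \<rightarrow>\<^bsub>?H\<^esub> u}"
    by (rule card_mono[rotated]) (simp add: finX induce_graph_of_simps)
  also have "\<dots> < m" using I(1) w(1) CI(1) by (auto simp: island_def)
  finally show False using w(2) by simp
qed

section \<open>Lower bounds on h-star\<close>

text \<open>
  The null graph is a witness: its choosability is 0, but the parameter \<^const>\<open>clustered_col\<close> is
  positive by definition.
\<close>

lemma one_le_h_star: "1 \<le> h_star 1 s"
  unfolding h_star_def
proof (rule Inf_greatest, clarify)
  fix s' p'
  assume *: "\<forall>G :: nat pair_pre_digraph. pair_graph G \<and> clustered_choosability 1 (with_proj G) \<le> enat s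
    \<longrightarrow> clustered_col p' (with_proj G) \<le> enat s'"
  let ?G = "graph_of {} {} :: nat pair_pre_digraph"
  have "pair_graph ?G" by (rule pair_graph_graph_of) (auto simp: irrefl_def)
  moreover have "clustered_choosability 1 (with_proj ?G) \<le> enat s"
    by (rule clustered_choosability_one_le) (auto simp: irrefl_def)
  ultimately have "clustered_col p' (with_proj ?G) \<le> enat s'" using * by blast
  moreover have "1 \<le> clustered_col p' (with_proj ?G)"
    unfolding clustered_col_def by (rule Inf_greatest) (auto simp: one_enat_def)
  ultimately show "1 \<le> enat s'" by (rule order_trans[rotated])
qed

text \<open>
  The numerical hypothesis is the one of \<open>exists_sparse_bipartite\<close> for \<open>n = 2 ^ s * q\<close> and
  \<open>t = 4 * q * s ^ (2 * r)\<close>, in which the factor \<open>q\<close> cancels. This leaves \<open>q\<close> free to be chosen so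
  large that \<open>t\<close> exceeds the cluster size \<open>p'\<close>. Half of \<open>t\<close> bounds the expected number of vertices, out of
  \<open>2 * n\<close>, that retain too few colours in a random split of the palette.
\<close>

theorem h_star_greater:
  assumes r: "3 \<le> r" "2 * r \<le> s"
    and num: "24 * (m + r) * (8 * (m + r) * s ^ (2 * r)) ^ (r - 1) \<le> (2 ^ s) ^ (r - 1)"
  shows "enat m < h_star 1 s"
proof -
  define d where "d = m + r"
  \<comment> \<open>A strict inequality need not survive the infimum, so \<open>Suc m\<close> is shown to be a lower bound.\<close>
  have "enat (Suc m) \<le> h_star 1 s"
    unfolding h_star_def
  proof (rule Inf_greatest, clarify)
    fix s' p'
    assume *: "\<forall>G :: nat pair_pre_digraph. pair_graph G \<and> clustered_choosability 1 (with_proj G) \<le> enat s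
      \<longrightarrow> clustered_col p' (with_proj G) \<le> enat s'"
    define q where "q = Suc p'"
    define n where "n = 2 ^ s * q"
    define t where "t = 4 * q * s ^ (2 * r)"
    define u where "u = 2 * q * s ^ (2 * r)"
    have n: "0 < n" by (simp add: n_def q_def)
    \<comment> \<open>There are \<open>n\<^sup>2\<close> possible edges, and \<open>2 * d * n\<close> of them are needed.\<close>
    have d: "2 * d \<le> n"
    proof -
      have "(8 * d * s ^ (2 * r)) ^ (r - 1) \<le> 24 * d * (8 * d * s ^ (2 * r)) ^ (r - 1)"
        using r by (simp add: d_def)
      also have "\<dots> \<le> (2 ^ s) ^ (r - 1)" using num by (simp add: d_def)
      finally have "8 * d * s ^ (2 * r) \<le> 2 ^ s" using r by (subst (asm) power_mono_iff) auto
      moreover have "2 * d * 1 \<le> 8 * d * s ^ (2 * r)" using r by (intro mult_le_mono) auto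
      moreover have "2 ^ s * 1 \<le> n" unfolding n_def by (intro mult_le_mono) (auto simp: q_def)
      ultimately show ?thesis by linarith
    qed
    have tq: "2 * d * t = 8 * d * s ^ (2 * r) * q" by (simp add: t_def)
    have "24 * d * (2 * d * t) ^ (r - 1) = 24 * d * (8 * d * s ^ (2 * r)) ^ (r - 1) * q ^ (r - 1)"
      unfolding tq power_mult_distrib[of _ q] by (simp only: mult.assoc)
    also have "\<dots> \<le> (2 ^ s) ^ (r - 1) * q ^ (r - 1)" using num by (simp add: d_def)
    also have "\<dots> = n ^ (r - 1)" by (simp add: n_def power_mult_distrib)
    finally have t: "24 * d * (2 * d * t) ^ (r - 1) \<le> n ^ (r - 1)" .
    define A where "A = {..<n}"
    define B where "B = {n..<2 * n}"
    define V where "V = A \<union> B"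
    obtain E where E: "E \<subseteq> A \<times> B" "card E = 2 * d * n" "sparse r t E"
      using exists_sparse_bipartite[OF r(1) d n t] unfolding A_def B_def by blast
    have disj: "A \<inter> B = {}" by (auto simp: A_def B_def)
    have V: "finite V" "V \<noteq> {}" "card V = 2 * n" "E \<subseteq> V \<times> V"
      using n E(1) disj by (auto simp: V_def A_def B_def card_Un_disjoint)
    have asym: "asym E" using E(1) disj by (auto intro!: asymI)
    have irr: "irrefl E" using E(1) disj by (auto simp: irrefl_def)
    have "clustered_choosability 1 (with_proj (graph_of V E)) \<le> enat s"
    proof (rule clustered_choosability_one_le[OF V(1,4) irr])
      fix L :: "nat \<Rightarrow> nat set" assume L: "\<And>v. v \<in> V \<Longrightarrow> finite (L v) \<and> card (L v) = s"
      have "card (A \<union> B) * s ^ (2 * r) \<le> u * 2 ^ s"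
        using V(3) by (simp add: V_def u_def n_def)
      moreover have "2 * u \<le> t" by (simp add: t_def u_def)
      ultimately obtain \<phi> where "\<And>v. v \<in> A \<union> B \<Longrightarrow> \<phi> v \<in> L v" "\<And>a b. (a, b) \<in> E \<Longrightarrow> \<phi> a \<noteq> \<phi> b"
        using sparse_bipartite_choosable[of A B E r t s u L] E disj r L
        by (auto simp: V_def A_def B_def)
      then show "\<exists>\<phi>. (\<forall>v\<in>V. \<phi> v \<in> L v) \<and> (\<forall>(u, v)\<in>E. \<phi> u \<noteq> \<phi> v)"
        by (auto simp: V_def)
    qed
    then have "clustered_col p' (with_proj (graph_of V E)) \<le> enat s'"
      using * pair_graph_graph_of[OF V(1,4) irr] by blast
    moreover have "enat m < clustered_col p' (with_proj (graph_of V E))"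
    proof (rule clustered_col_greater[OF V(1,2,4) E(3) asym])
      show "d * card V \<le> card E" by (simp add: V E)
      show "m + r \<le> d" by (simp add: d_def)
      have "p' * 1 \<le> (4 * q) * s ^ (2 * r)" using r by (intro mult_le_mono) (auto simp: q_def)
      then show "p' \<le> t" by (simp add: t_def)
    qed
    ultimately have "enat m < enat s'" by (rule less_le_trans[rotated])
    then show "enat (Suc m) \<le> enat s'" by simp
  qed
  then show ?thesis by (meson enat_ord_simps(2) lessI less_le_trans)
qed

section \<open>Asymptotics\<close>

lemma eventually_power_le_powr:
  fixes K a :: real
  assumes "0 < a"
  shows "\<forall>\<^sub>F s in sequentially. K * real s ^ k \<le> 2 powr (a * real s)"
proof -
  define c where "c = a * ln 2"
  have c: "0 < c" using assms by (simp add: c_def)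
  have "filterlim (\<lambda>s. c * real s) at_top sequentially"
    using c by (intro filterlim_tendsto_pos_mult_at_top[OF tendsto_const] filterlim_real_sequentially)
  then have "(\<lambda>s. (c * real s) ^ k / exp (c * real s)) \<longlonglongrightarrow> 0"
    by (rule filterlim_compose[OF tendsto_power_div_exp_0])
  then have "\<forall>\<^sub>F s in sequentially. (c * real s) ^ k / exp (c * real s) < c ^ k / (\<bar>K\<bar> + 1)"
    using c by (intro order_tendstoD(2)) auto
  then show ?thesis
  proof eventually_elim
    case (elim s)
    then have "c ^ k * (real s ^ k * (\<bar>K\<bar> + 1)) < c ^ k * exp (c * real s)"
      by (simp add: field_simps power_mult_distrib)
    then have "real s ^ k * (\<bar>K\<bar> + 1) < exp (c * real s)" using c by simp
    moreover have "K * real s ^ k \<le> real s ^ k * (\<bar>K\<bar> + 1)"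
      by (subst mult.commute) (intro mult_left_mono, auto)
    moreover have "2 powr (a * real s) = exp (c * real s)" by (simp add: c_def powr_def ac_simps)
    ultimately show ?case by simp
  qed
qed

text \<open>
  With \<open>y = 2 powr ((1 - \<delta>) * s)\<close> the inner power has a base of at most \<open>2 powr ((1 - \<delta> / 2) * s)\<close>,
  half of the gain \<open>\<delta>\<close> being spent on the factor \<open>s ^ (2 * r)\<close>. Compared with the right-hand side, the
  power saves a factor \<open>2 powr (\<delta> * s * (r - 1) / 2)\<close>, and \<open>r\<close> is chosen so that this is at
  least \<open>2 powr s\<close>, which pays for the outer factor.
\<close>

lemma eventually_sparse_parameters:
  fixes \<delta> :: real
  assumes \<delta>: "0 < \<delta>" "\<delta> < 1"
  obtains r where "3 \<le> r"
    "\<forall>\<^sub>F s in sequentially. 2 * r \<le> s \<and>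
      24 * (nat \<lfloor>2 powr ((1 - \<delta>) * real s)\<rfloor> + r) *
        (8 * (nat \<lfloor>2 powr ((1 - \<delta>) * real s)\<rfloor> + r) * s ^ (2 * r)) ^ (r - 1)
      \<le> (2 ^ s) ^ (r - 1)"
proof -
  define r where "r = nat \<lceil>2 / \<delta>\<rceil> + 3"
  have r: "3 \<le> r" by (simp add: r_def)
  have rd: "2 \<le> real (r - 1) * \<delta>"
  proof -
    have "2 / \<delta> \<le> real (r - 1)" by (simp add: r_def) linarith
    then show ?thesis using pos_divide_le_eq[OF \<delta>(1)] by blast
  qed
  have 1: "\<forall>\<^sub>F s in sequentially. 2 * r \<le> s" by (rule eventually_ge_at_top)
  have 2: "\<forall>\<^sub>F s in sequentially. real r \<le> 2 powr ((1 - \<delta>) * real s)"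
    using eventually_power_le_powr[of "1 - \<delta>" "real r" 0] \<delta> by simp
  have 3: "\<forall>\<^sub>F s in sequentially. 16 * real s ^ (2 * r) \<le> 2 powr (\<delta> / 2 * real s)"
    using eventually_power_le_powr[of "\<delta> / 2" 16 "2 * r"] \<delta> by simp
  have 4: "\<forall>\<^sub>F s in sequentially. 48 \<le> 2 powr (\<delta> * real s)"
    using eventually_power_le_powr[of \<delta> 48 0] \<delta> by simp
  show thesis
  proof (rule that[OF r])
    show "\<forall>\<^sub>F s in sequentially. 2 * r \<le> s \<and>
      24 * (nat \<lfloor>2 powr ((1 - \<delta>) * real s)\<rfloor> + r) *
        (8 * (nat \<lfloor>2 powr ((1 - \<delta>) * real s)\<rfloor> + r) * s ^ (2 * r)) ^ (r - 1)
      \<le> (2 ^ s) ^ (r - 1)"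
      using 1 2 3 4
    proof eventually_elim
      case (elim s)
      define y where "y = 2 powr ((1 - \<delta>) * real s)"
      define k where "k = r - 1"
      let ?m = "nat \<lfloor>y\<rfloor>"
      have y: "0 < y" by (simp add: y_def)
      have d: "real (?m + r) \<le> 2 * y" using elim(2) y by (simp add: y_def[symmetric]) linarith
      have e: "8 * real (?m + r) * real s ^ (2 * r) \<le> 2 powr ((1 - \<delta> / 2) * real s)"
      proof -
        have "8 * real (?m + r) * real s ^ (2 * r) \<le> 8 * (2 * y) * real s ^ (2 * r)"
          using d by (intro mult_right_mono mult_left_mono) auto
        also have "\<dots> = y * (16 * real s ^ (2 * r))" by simp
        also have "\<dots> \<le> y * 2 powr (\<delta> / 2 * real s)" using elim(3) y by (intro mult_left_mono) auto
        also have "\<dots> = 2 powr ((1 - \<delta> / 2) * real s)"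
          unfolding y_def powr_add[symmetric] by (simp add: algebra_simps)
        finally show ?thesis .
      qed
      have "24 * real (?m + r) * (8 * real (?m + r) * real s ^ (2 * r)) ^ k
          \<le> 24 * (2 * y) * (2 powr ((1 - \<delta> / 2) * real s)) ^ k"
        using d e y by (intro mult_mono power_mono) auto
      also have "\<dots> = 48 * (2 powr ((1 - \<delta>) * real s) * 2 powr ((1 - \<delta> / 2) * real s * real k))"
        by (simp add: y_def powr_realpow[symmetric] powr_powr)
      also have "\<dots> \<le> 2 powr (\<delta> * real s) * (2 powr ((1 - \<delta>) * real s) * 2 powr ((1 - \<delta> / 2) * real s * real k))"
        using elim(4) by (intro mult_right_mono) auto
      also have "\<dots> = 2 powr (real s + (1 - \<delta> / 2) * real s * real k)"
        by (simp add: powr_add[symmetric] algebra_simps)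
      also have "\<dots> \<le> 2 powr (real s * real k)"
      proof -
        have "real s * 2 \<le> real s * (real k * \<delta>)" using rd by (intro mult_left_mono) (simp_all only: k_def of_nat_0_le_iff)
        then have "real s + (1 - \<delta> / 2) * real s * real k \<le> real s * real k"
          by (simp add: algebra_simps)
        then show ?thesis by simp
      qed
      also have "\<dots> = (2 ^ s) ^ k" by (simp add: powr_realpow[symmetric] powr_powr)
      finally have "real (24 * (?m + r) * (8 * (?m + r) * s ^ (2 * r)) ^ k) \<le> real ((2 ^ s) ^ k)"
        by simp
      then have "24 * (?m + r) * (8 * (?m + r) * s ^ (2 * r)) ^ k \<le> (2 ^ s) ^ k"
        by (simp only: of_nat_le_iff)
      then show ?case using elim(1) by (simp add: y_def k_def)
    qed
  qed
qed

text \<open>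
  The exponent is obtained by solving for \<open>\<epsilon> s\<close>. Since \<open>h s\<close> may be infinite, or so large that the
  solution would not tend to 0, it is first capped at \<open>2 ^ s\<close>; \<open>1 \<le> h s\<close> makes the logarithm
  meaningful for every \<open>s\<close>.
\<close>

lemma exponent_tendsto_zero:
  fixes h :: "nat \<Rightarrow> enat"
  assumes one: "\<And>s. 1 \<le> h s"
    and ev: "\<And>\<delta> :: real. 0 < \<delta> \<Longrightarrow> \<delta> < 1 \<Longrightarrow> \<forall>\<^sub>F s in sequentially. enat (nat \<lfloor>2 powr ((1 - \<delta>) * real s)\<rfloor>) < h s"
    and c: "0 < c"
  shows "\<exists>\<epsilon> :: nat \<Rightarrow> real. \<epsilon> \<longlonglongrightarrow> 0 \<and>
    (\<forall>s \<ge> 1. ereal_of_enat (h s) \<ge> ereal (c * 2 powr ((1 + \<epsilon> s) * real s)))"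
proof -
  define g where "g = (\<lambda>s. the_enat (min (h s) (enat (2 ^ s))))"
  have g: "enat (g s) = min (h s) (enat (2 ^ s))" for s
    by (cases "h s") (auto simp: g_def min_def)
  have g1: "1 \<le> g s" for s
  proof -
    have "enat 1 \<le> enat (g s)" using one[of s] by (simp add: g one_enat_def)
    then show ?thesis by simp
  qed
  have g2: "real (g s) \<le> 2 powr real s" for s
  proof -
    have "enat (g s) \<le> enat (2 ^ s)" by (simp add: g)
    then have "real (g s) \<le> real (2 ^ s)" by (simp only: enat_ord_simps of_nat_le_iff)
    then show ?thesis by (simp add: powr_realpow)
  qed
  define \<epsilon> where "\<epsilon> = (\<lambda>s. log 2 (g s / c) / s - 1)"
  have lim: "\<epsilon> \<longlonglongrightarrow> 0"
  proof (rule tendstoI)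
    fix e :: real assume "0 < e"
    define \<delta> where "\<delta> = min (e / 2) (1 / 2)"
    have \<delta>: "0 < \<delta>" "\<delta> < 1" "\<delta> \<le> e / 2" using \<open>0 < e\<close> by (auto simp: \<delta>_def)
    have "\<forall>\<^sub>F s in sequentially. \<bar>log 2 c / real s\<bar> < e / 2"
      using order_tendstoD(2)[OF tendsto_rabs_zero[OF lim_const_over_n[of "log 2 c"]], of "e / 2"] \<open>0 < e\<close> by simp
    with ev[OF \<delta>(1,2)] eventually_gt_at_top[of 0] show "\<forall>\<^sub>F s in sequentially. dist (\<epsilon> s) 0 < e"
    proof eventually_elim
      case (elim s)
      let ?y = "2 powr ((1 - \<delta>) * real s)"
      have "?y \<le> real (g s)"
      proof (cases "h s \<le> enat (2 ^ s)")
        case True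
        then have "enat (g s) = h s" by (simp add: g)
        then have "nat \<lfloor>?y\<rfloor> < g s" using elim(1) by (metis enat_ord_simps(2))
        then show ?thesis by linarith
      next
        case False
        then have "enat (g s) = enat (2 ^ s)" by (simp add: g)
        then have "real (g s) = 2 powr real s" by (simp add: powr_realpow)
        then show ?thesis using \<delta> by (simp add: mult_left_le_one_le)
      qed
      then have "log 2 ?y \<le> log 2 (g s)" using g1[of s] by (subst log_le_cancel_iff) auto
      then have lo: "(1 - \<delta>) * real s \<le> log 2 (g s)" by simp
      have "log 2 (g s) \<le> log 2 (2 powr real s)"
        using g1[of s] g2[of s] by (subst log_le_cancel_iff) auto
      then have hi: "log 2 (g s) \<le> real s" by simp
      have lo': "1 - \<delta> \<le> log 2 (g s) / s" using lo elim(2) by (simp add: field_simps)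
      have hi': "log 2 (g s) / s \<le> 1" using hi elim(2) by (simp add: field_simps)
      have "\<epsilon> s = log 2 (g s) / s - log 2 c / s - 1"
        using c g1[of s] by (simp add: \<epsilon>_def log_divide diff_divide_distrib)
      then show ?case using lo' hi' elim(3) \<delta> unfolding dist_real_def by linarith
    qed
  qed
  have "ereal (c * 2 powr ((1 + \<epsilon> s) * real s)) \<le> ereal_of_enat (h s)" if s: "1 \<le> s" for s
  proof -
    have "(1 + \<epsilon> s) * real s = log 2 (g s / c)" using s by (simp add: \<epsilon>_def)
    then have "c * 2 powr ((1 + \<epsilon> s) * real s) = real (g s)"
      using c g1[of s] by simp
    then have "ereal (c * 2 powr ((1 + \<epsilon> s) * real s)) = ereal_of_enat (enat (g s))" by simp
    also have "\<dots> \<le> ereal_of_enat (h s)" by (simp add: g)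
    finally show ?thesis .
  qed
  then show ?thesis using lim by blast
qed

theorem corollary13:
  shows "\<exists>\<epsilon> :: nat \<Rightarrow> real. \<epsilon> \<longlonglongrightarrow> 0 \<and>
    (\<forall>s \<ge> 1. ereal_of_enat (h_star 1 s) \<ge> ereal (1 / 5 * 2 powr ((1 + \<epsilon> s) * real s)))"
proof (rule exponent_tendsto_zero)
  show "1 \<le> h_star 1 s" for s by (rule one_le_h_star)
  fix \<delta> :: real assume \<delta>: "0 < \<delta>" "\<delta> < 1"
  obtain r where "3 \<le> r" and ev: "\<forall>\<^sub>F s in sequentially. 2 * r \<le> s \<and>
      24 * (nat \<lfloor>2 powr ((1 - \<delta>) * real s)\<rfloor> + r) *
        (8 * (nat \<lfloor>2 powr ((1 - \<delta>) * real s)\<rfloor> + r) * s ^ (2 * r)) ^ (r - 1) \<le> (2 ^ s) ^ (r - 1)"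
    using eventually_sparse_parameters[OF \<delta>] by blast
  show "\<forall>\<^sub>F s in sequentially. enat (nat \<lfloor>2 powr ((1 - \<delta>) * real s)\<rfloor>) < h_star 1 s"
    using ev by eventually_elim (use \<open>3 \<le> r\<close> h_star_greater in blast)
qed simp

end
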